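(* Let $K$ be a finite simplicial complex with nonempty vertex set, $s\ge1$ and $r\ge1$. The number $S(K,r,s)$ of partitions of $V(K)$ into $r$ blocks none of which contains an $s$-simplex of $K$ satisfies \[ S(K,r,s)=\sum_{T\in L^s(K)}\mu(\emptyset,T)\,S(|\pi(T)|,r), \] where $\mu$ is the Möbius function of $L^s(K)$ and $S(n,r)$ denotes the Stirling number of the second kind.
   Context: An $s$-simplex of $K$ is a face with $s+1$ vertices; $F^s(K)$ is the set of them. For $S\subseteq F^s(K)$: the connected components of $S$ are the equivalence classes of the smallest equivalence relation on $S$ relating simplices with nonempty intersection; $V(S)=\bigcup S$; $S$ is closed if $\{\sigma\in F^s(K)\mid\sigma\subseteq V(S)\}=S$; $\pi(S)$ is the partition of $V(K)$ whose blocks are the vertex sets of the connected components of $S$ together with singletons $\{v\}$ for $v\in V(K)\setminus V(S)$. $L^s(K)$ is the set of subsets of $F^s(K)$ all of whose connected components are closed, ordered by inclusion, with least element $\emptyset$. *)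

theory Defs
  imports "HOL-Library.Disjoint_Sets" "HOL-Combinatorics.Stirling"
begin

(* The empty face is neither required nor forbidden, so both usual conventions are covered.
   Every element of \<Union>K is a vertex: closure under nonempty subsets puts its singleton in K. *)
definition abstract_complex :: "'a set set \<Rightarrow> bool" where
  "abstract_complex K \<longleftrightarrow>
     (\<forall>\<sigma>\<in>K. finite \<sigma>) \<and> (\<forall>\<sigma>\<in>K. \<forall>\<tau>. \<tau> \<subseteq> \<sigma> \<and> \<tau> \<noteq> {} \<longrightarrow> \<tau> \<in> K)"

definition vertices :: "'a set set \<Rightarrow> 'a set" where
  "vertices S = \<Union>S"

definition simplices :: "nat \<Rightarrow> 'a set set \<Rightarrow> 'a set set" where
  "simplices s K = {\<sigma> \<in> K. card \<sigma> = s + 1}"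

definition connected_rel :: "'a set set \<Rightarrow> ('a set \<times> 'a set) set" where
  "connected_rel S = \<Inter>{R. equiv S R \<and> {(\<sigma>, \<tau>). \<sigma> \<in> S \<and> \<tau> \<in> S \<and> \<sigma> \<inter> \<tau> \<noteq> {}} \<subseteq> R}"

lemma equiv_connected_rel: "equiv S (connected_rel S)"
proof -
  have "equiv S (S \<times> S)"
    by (auto simp: equiv_def refl_on_def sym_def trans_def)
  then have sub: "connected_rel S \<subseteq> S \<times> S"
    unfolding connected_rel_def by blast
  have "refl_on S (connected_rel S)"
    unfolding connected_rel_def by (auto simp: refl_on_def equiv_def)
  moreover have "sym (connected_rel S)"
    unfolding connected_rel_def by (rule symI) (auto simp: equiv_def dest: symD)
  moreover have "trans (connected_rel S)"
    unfolding connected_rel_def by (rule transI) (auto simp: equiv_def dest: transD)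
  ultimately show ?thesis
    using sub by (simp add: equiv_def)
qed

lemma connected_rel_Int:
  "\<lbrakk>\<sigma> \<in> S; \<tau> \<in> S; \<sigma> \<inter> \<tau> \<noteq> {}\<rbrakk> \<Longrightarrow> (\<sigma>, \<tau>) \<in> connected_rel S"
  unfolding connected_rel_def by blast

definition conn_components :: "'a set set \<Rightarrow> 'a set set set" where
  "conn_components S = S // connected_rel S"

definition closed_simplices :: "nat \<Rightarrow> 'a set set \<Rightarrow> 'a set set \<Rightarrow> bool" where
  "closed_simplices s K S \<longleftrightarrow> {\<sigma> \<in> simplices s K. \<sigma> \<subseteq> vertices S} = S"

definition simplex_partition :: "'a set set \<Rightarrow> 'a set set \<Rightarrow> 'a set set" where
  "simplex_partition K S =
     vertices ` conn_components S \<union> (\<lambda>v. {v}) ` (vertices K - vertices S)"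

definition simplex_lattice :: "nat \<Rightarrow> 'a set set \<Rightarrow> 'a set set set" where
  "simplex_lattice s K =
     {S. S \<subseteq> simplices s K \<and> (\<forall>C\<in>conn_components S. closed_simplices s K C)}"

(* Moebius function of a finite subset P of an ordered type, with the induced order.
   For families of sets, \<le> is inclusion. The value is 0 outside the intended domain. *)
function mobius :: "'b::order set \<Rightarrow> 'b \<Rightarrow> 'b \<Rightarrow> int" where
  "mobius P x y =
     (if finite P \<and> x \<in> P \<and> y \<in> P \<and> x \<le> y
      then if x = y then 1 else - (\<Sum>z\<in>{z \<in> P. x \<le> z \<and> z < y}. mobius P x z)
      else 0)"
  by pat_completeness auto
termination
proof (relation "measure (\<lambda>(P, x, y). card {w \<in> P. w < y})", goal_cases)
  case 1
  show ?case by simp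
next
  case (2 P x y z)
  then have "{w \<in> P. w < z} \<subset> {w \<in> P. w < y}"
    by (auto dest: order.strict_trans)
  then show ?case
    using 2 by (auto intro: psubset_card_mono)
qed

declare mobius.simps [simp del]

definition simplicial_Stirling :: "'a set set \<Rightarrow> nat \<Rightarrow> nat \<Rightarrow> nat" where
  "simplicial_Stirling K r s =
     card {P. partition_on (vertices K) P \<and> card P = r \<and>
              (\<forall>B\<in>P. \<not> (\<exists>\<sigma>\<in>simplices s K. \<sigma> \<subseteq> B))}"

end

theory Submission
  imports Defs
begin

text \<open>
  Send a partition \<open>P\<close> of the vertex set to the set \<open>m(P)\<close> of all \<open>s\<close>-simplices contained in a
  block of \<open>P\<close>. It lies in \<open>L\<^sup>s(K)\<close>, and \<open>T \<subseteq> m(P)\<close> holds iff \<open>\<pi>(T)\<close> refines \<open>P\<close>. The coarsenings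
  of \<open>\<pi>(T)\<close> into \<open>r\<close> blocks correspond to the partitions of the set \<open>\<pi>(T)\<close> into \<open>r\<close> blocks, so the
  right-hand side is \<open>\<Sum>\<^sub>P \<Sum>\<^sub>T \<mu>(\<emptyset>,T)\<close> with \<open>T \<subseteq> m(P)\<close>, where by the defining property of \<open>\<mu>\<close> the
  inner sum is 1 if \<open>m(P) = \<emptyset>\<close> and 0 otherwise.
\<close>

section \<open>Counting partitions\<close>

text \<open>This is the Stirling recurrence for sets. If \<open>{a}\<close> is a block, deleting it
  leaves a partition of \<open>A\<close> into \<open>k\<close> blocks. Otherwise removing
  \<open>a\<close> from its block leaves a partition of \<open>A\<close> into \<open>Suc k\<close>
  blocks with one block marked.\<close>

lemma card_partitions_insert:
  assumes "finite A" and "a \<notin> A"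
  shows "card {P. partition_on (insert a A) P \<and> card P = Suc k} =
    Suc k * card {P. partition_on A P \<and> card P = Suc k} + card {P. partition_on A P \<and> card P = k}"
proof -
  define parts where "parts A k = {P. partition_on A P \<and> card P = k}" for A :: "'a set" and k
  \<comment> \<open>\<open>pairs\<close> consists of the partitions with a marked block;
    \<open>add\<close> puts \<open>a\<close> into the marked block.\<close>
  define add where "add = (\<lambda>(P, B). insert (insert a B) (P - {B}))"
  define pairs where "pairs = (SIGMA P : parts A (Suc k). P)"
  have fin: "finite (parts A j)" for j
    unfolding parts_def
    by (rule finite_subset[OF _ finitely_many_partition_on[OF assms(1)]]) auto
  have fin_part: "finite P" if "P \<in> parts A j" for P j
    using that assms(1) by (auto simp: parts_def intro: finite_elements)
  have a_notin: "a \<notin> B" if "P \<in> parts A j" "B \<in> P" for P j B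
    using that assms(2) by (auto simp: parts_def partition_on_def)
  have single_notin: "{a} \<notin> P" if "P \<in> parts A j" for P j
    using a_notin[OF that] by blast
  have add_in: "add (P, B) \<in> parts (insert a A) (Suc k) \<and> {a} \<notin> add (P, B)"
    if "P \<in> parts A (Suc k)" "B \<in> P" for P B
  proof -
    have P: "partition_on A P" "card P = Suc k" using that by (auto simp: parts_def)
    have ins: "insert a B \<notin> P" using a_notin[OF that(1)] by blast
    have Bne: "B \<noteq> {}" "a \<notin> B" using P that a_notin by (auto simp: partition_on_def)
    have "partition_on (A - B) (P - {B})"
      using P(1) that(2) partition_on_insert[of B "P - {B}" A]
      by (auto simp: partition_on_def disjnt_def disjoint_def insert_absorb)
    moreover have "disjnt (insert a B) (\<Union>(P - {B}))"
      using P(1) that(2) assms(2) by (auto simp: partition_on_def disjnt_def disjoint_def)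
    moreover have "insert a A - insert a B = A - B" "B \<subseteq> A"
      using P(1) that(2) assms(2) Bne by (auto simp: partition_on_def)
    ultimately have "partition_on (insert a A) (add (P, B))"
      unfolding add_def by (auto simp: partition_on_insert)
    moreover have "card (add (P, B)) = Suc k"
      using ins that(2) P(2) fin_part[OF that(1)] by (simp add: add_def card.remove[symmetric])
    ultimately show ?thesis
      using Bne single_notin[OF that(1)] by (auto simp: parts_def add_def)
  qed
  have "inj_on (insert {a}) (parts A k)"
    by (rule inj_onI) (metis insert_ident single_notin)
  then have c1: "card (insert {a} ` parts A k) = card (parts A k)"
    by (rule card_image)
  have "inj_on add pairs"
  proof (rule inj_onI, clarsimp simp: pairs_def)
    fix P B P' B'
    assume P: "P \<in> parts A (Suc k)" "B \<in> P" and P': "P' \<in> parts A (Suc k)" "B' \<in> P'"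
      and eq: "add (P, B) = add (P', B')"
    have nP: "\<forall>C\<in>P. a \<notin> C" and nP': "\<forall>C\<in>P'. a \<notin> C"
      using a_notin[OF P(1)] a_notin[OF P'(1)] by auto
    \<comment> \<open>The image has only one block that contains \<open>a\<close>, so this block
      determines the marked block and the remaining blocks.\<close>
    have "insert a B \<in> add (P', B')" using eq[symmetric] by (simp add: add_def)
    then have "insert a B = insert a B'"
      using nP' by (auto simp: add_def)
    then have B: "B = B'" using nP nP' P(2) P'(2) by (metis insert_ident)
    have "insert a B \<notin> P - {B}" "insert a B \<notin> P' - {B}"
      using nP nP' by auto
    then have "P - {B} = P' - {B}" using eq B by (simp add: add_def insert_ident)
    then show "P = P' \<and> B = B'" using B P(2) P'(2) by blast
  qed
  then have "card (add ` pairs) = card pairs" by (rule card_image)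
  also have "\<dots> = (\<Sum>P\<in>parts A (Suc k). card P)"
    unfolding pairs_def using fin fin_part by (intro card_SigmaI) auto
  also have "\<dots> = Suc k * card (parts A (Suc k))"
    by (simp add: parts_def)
  finally have c2: "card (add ` pairs) = Suc k * card (parts A (Suc k))" .
  have "parts (insert a A) (Suc k) = add ` pairs \<union> insert {a} ` parts A k"
  proof (intro equalityI subsetI)
    fix Q assume "Q \<in> parts (insert a A) (Suc k)"
    then have Q: "partition_on (insert a A) Q" "card Q = Suc k" "finite Q"
      using assms(1) finite_elements[of "insert a A" Q] by (auto simp: parts_def)
    then obtain C where C: "C \<in> Q" "a \<in> C" by (auto simp: partition_on_def)
    have disj: "disjnt C (\<Union>(Q - {C}))"
      using Q(1) C(1) by (auto simp: partition_on_def disjnt_def disjoint_def)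
    then have rest: "partition_on (insert a A - C) (Q - {C})" "C \<subseteq> insert a A"
      using partition_on_insert[OF disj, of "insert a A"] Q(1) C(1) by (auto simp: insert_absorb)
    have cQ: "card (Q - {C}) = k" using Q C by simp
    show "Q \<in> add ` pairs \<union> insert {a} ` parts A k"
    proof (cases "C = {a}")
      case True
      then have "Q - {C} \<in> parts A k"
        using rest cQ assms(2) by (simp add: parts_def)
      moreover have "Q = insert {a} (Q - {C})" using True C by auto
      ultimately show ?thesis by blast
    next
      case False
      \<comment> \<open>The marked block of the preimage; it is nonempty because \<open>C\<close> is
        not \<open>{a}\<close>.\<close>
      define B where "B = C - {a}"
      have B: "B \<noteq> {}" "insert a B = C" "B \<subseteq> A" "A - B = insert a A - C"
        using False C rest(2) assms(2) by (auto simp: B_def)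
      have dB: "disjnt B (\<Union>(Q - {C}))" using disj by (auto simp: B_def disjnt_def)
      have nB: "B \<notin> Q - {C}" using dB B(1) by (auto simp: disjnt_def)
      have "partition_on A (insert B (Q - {C}))"
        using rest(1) B partition_on_insert[OF dB] by simp
      moreover have "card (insert B (Q - {C})) = Suc k"
        using nB cQ Q(3) by simp
      ultimately have "(insert B (Q - {C}), B) \<in> pairs"
        by (simp add: pairs_def parts_def)
      moreover have "Q = add (insert B (Q - {C}), B)"
        using nB B(2) C(1) by (auto simp: add_def)
      ultimately show ?thesis by blast
    qed
  next
    fix Q assume "Q \<in> add ` pairs \<union> insert {a} ` parts A k"
    then show "Q \<in> parts (insert a A) (Suc k)"
    proof
      assume "Q \<in> add ` pairs" then show ?thesis using add_in by (auto simp: pairs_def)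
    next
      assume "Q \<in> insert {a} ` parts A k"
      then obtain P where P: "P \<in> parts A k" "Q = insert {a} P" by auto
      moreover have "disjnt {a} (\<Union>P)" using a_notin[OF P(1)] by auto
      ultimately show ?thesis
        using assms(2) fin_part[OF P(1)] single_notin[OF P(1)]
        by (auto simp: parts_def partition_on_insert)
    qed
  qed
  \<comment> \<open>The two kinds of partition differ in whether \<open>{a}\<close> is a
    block.\<close>
  moreover have "add ` pairs \<inter> insert {a} ` parts A k = {}"
    using add_in by (fastforce simp: pairs_def)
  moreover have "finite (add ` pairs)" "finite (insert {a} ` parts A k)"
    using fin fin_part by (auto simp: pairs_def)
  ultimately have "card (parts (insert a A) (Suc k)) =
      Suc k * card (parts A (Suc k)) + card (parts A k)"
    using c1 c2 by (simp add: card_Un_disjoint)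
  then show ?thesis by (simp add: parts_def)
qed

theorem card_partition_on_eq_Stirling:
  assumes "finite A"
  shows "card {P. partition_on A P \<and> card P = k} = Stirling (card A) k"
  using assms
proof (induction A arbitrary: k rule: finite_induct)
  case empty
  have "{P. partition_on {} P \<and> card P = k} = (if k = 0 then {{} :: 'a set set} else {})"
    by (auto simp: partition_on_empty)
  then show ?case by (cases k) (simp_all del: Collect_empty_eq)
next
  case (insert a A)
  show ?case
  proof (cases k)
    case 0
    \<comment> \<open>A nonempty set has no partition into zero blocks, which matches
      \<open>Stirling (Suc n) 0 = 0\<close>.\<close>
    have "card P \<noteq> 0" if P: "partition_on (insert a A) P" for P
      using finite_elements[OF _ P] insert.hyps P by (auto simp: partition_on_def)
    then have "{P. partition_on (insert a A) P \<and> card P = k} = {}"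
      using 0 by blast
    then show ?thesis using 0 insert.hyps by (simp del: Collect_empty_eq)
  next
    case (Suc j)
    then show ?thesis
      using insert card_partitions_insert[OF insert.hyps, of j] by simp
  qed
qed

section \<open>Coarsenings of a partition\<close>

text \<open>Blocks are nonempty and pairwise disjoint, so a set of blocks is recovered from its
  union as the set of blocks that meet it.\<close>

lemma inj_on_Union_Pow_partition:
  assumes "partition_on A Q"
  shows "inj_on Union (Pow Q)"
proof (rule inj_onI)
  have sub: "X \<subseteq> Y" if "X \<subseteq> Q" "Y \<subseteq> Q" "\<Union>X = \<Union>Y" for X Y
  proof
    fix q assume "q \<in> X"
    moreover obtain v where "v \<in> q"
      using assms \<open>X \<subseteq> Q\<close> \<open>q \<in> X\<close> by (fastforce simp: partition_on_def)
    ultimately obtain q' where "q' \<in> Y" "v \<in> q'" using \<open>\<Union>X = \<Union>Y\<close> by blast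
    moreover have "q = q'"
      using assms that \<open>q \<in> X\<close> \<open>v \<in> q\<close> \<open>q' \<in> Y\<close> \<open>v \<in> q'\<close>
      unfolding partition_on_def disjoint_def by blast
    ultimately show "q \<in> Y" by simp
  qed
  show "X = Y" if "X \<in> Pow Q" "Y \<in> Pow Q" "\<Union>X = \<Union>Y" for X Y
    using sub[of X Y] sub[of Y X] that by auto
qed

text \<open>Merging the blocks of \<open>Q\<close> according to a partition \<open>R\<close> of the
  set \<open>Q\<close> is one direction of the correspondence with coarsenings of
  \<open>Q\<close>.\<close>

lemma refines_Union_image:
  assumes Q: "partition_on A Q" and R: "partition_on Q R"
  shows "refines A Q (Union ` R)"
proof -
  have "partition_on A (Union ` R)"
  proof (rule partition_onI)
    show "\<Union> (Union ` R) = A"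
      using Q R by (auto simp: partition_on_def)
    show "{} \<notin> Union ` R"
    proof
      assume "{} \<in> Union ` R"
      then obtain X where X: "X \<in> R" "\<Union>X = {}" by auto
      then obtain q where "q \<in> X" using R by (metis all_not_in_conv partition_onD3)
      then have "q \<in> Q" "q = {}" using X R by (auto simp: partition_on_def)
      then show False using Q by (auto simp: partition_on_def)
    qed
    fix p p' assume "p \<in> Union ` R" "p' \<in> Union ` R" "p \<noteq> p'"
    then obtain X Y where XY: "X \<in> R" "Y \<in> R" "p = \<Union>X" "p' = \<Union>Y" "X \<noteq> Y" by auto
    have "q \<inter> q' = {}" if "q \<in> X" "q' \<in> Y" for q q'
    proof -
      have "q \<in> Q" "q' \<in> Q" "q \<noteq> q'"
        using that XY R by (auto simp: partition_on_def disjoint_def)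
      then show ?thesis using Q by (auto simp: partition_on_def disjoint_def)
    qed
    then show "disjnt p p'" using XY by (auto simp: disjnt_def)
  qed
  moreover have "\<exists>Y\<in>Union ` R. X \<subseteq> Y" if "X \<in> Q" for X
    using that R by (auto simp: partition_on_def)
  ultimately show ?thesis using Q by (simp add: refines_def)
qed

text \<open>The converse direction: \<open>R\<close> groups the blocks of \<open>Q\<close> by the
  block of \<open>P\<close> that contains them.\<close>

lemma refines_eq_Union_image:
  assumes "refines A Q P"
  obtains R where "partition_on Q R" and "P = Union ` R"
proof
  let ?below = "\<lambda>p. {q \<in> Q. q \<subseteq> p}"
  have part: "partition_on A Q" "partition_on A P" "\<forall>q\<in>Q. \<exists>p\<in>P. q \<subseteq> p"
    using assms by (auto simp: refines_def)
  have Un: "\<Union>(?below p) = p" if "p \<in> P" for p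
    using refines_obtains_subset[OF assms that] by (simp add: partition_on_def)
  then show "P = Union ` ?below ` P"
    by (simp add: image_image)
  show "partition_on Q (?below ` P)"
  proof (rule partition_onI)
    show "\<Union>(?below ` P) = Q" using part(3) by auto
    show "{} \<notin> ?below ` P"
    proof
      assume "{} \<in> ?below ` P"
      then obtain p where "p \<in> P" "?below p = {}" by auto
      with Un[of p] have "{} \<in> P" by simp
      then show False using part(2) by (simp add: partition_on_def)
    qed
    fix X Y assume "X \<in> ?below ` P" "Y \<in> ?below ` P" "X \<noteq> Y"
    then obtain p p' where p: "p \<in> P" "p' \<in> P" "X = ?below p" "Y = ?below p'" "p \<noteq> p'" by blast
    then have "p \<inter> p' = {}" using part(2) by (auto simp: partition_on_def disjoint_def)
    \<comment> \<open>A block of \<open>Q\<close> below both \<open>p\<close> and \<open>p'\<close>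
      would lie in their empty intersection.\<close>
    moreover have "{} \<notin> Q" using part(1) by (simp add: partition_on_def)
    ultimately show "disjnt X Y"
      unfolding p disjnt_def by (auto) (metis Int_greatest subset_empty)
  qed
qed

lemma card_coarsenings:
  assumes "finite A" and Q: "partition_on A Q"
  shows "card {P. refines A Q P \<and> card P = r} = Stirling (card Q) r"
proof -
  let ?parts = "{R. partition_on Q R \<and> card R = r}"
  have inj: "inj_on Union R" if "partition_on Q R" for R
    using that by (intro inj_on_subset[OF inj_on_Union_Pow_partition[OF Q]])
      (auto simp: partition_on_def)
  have "{P. refines A Q P \<and> card P = r} = (`) Union ` ?parts"
  proof (intro equalityI subsetI)
    fix P assume P: "P \<in> {P. refines A Q P \<and> card P = r}"
    then obtain R where "partition_on Q R" "P = Union ` R"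
      using refines_eq_Union_image by blast
    then show "P \<in> (`) Union ` ?parts"
      using P by (auto simp: card_image inj)
  qed (auto simp: card_image inj refines_Union_image[OF Q])
  \<comment> \<open>Injectivity on sets of blocks lifts to families of such sets, so different
    \<open>R\<close> give different coarsenings.\<close>
  moreover have "inj_on ((`) Union) ?parts"
  proof (rule inj_on_subset)
    show "inj_on ((`) Union) (Pow (Pow Q))"
      using inj_on_Union_Pow_partition[OF Q] by (rule inj_on_image_Pow)
  qed (auto simp: partition_on_def)
  ultimately have "card {P. refines A Q P \<and> card P = r} = card ?parts"
    by (simp add: card_image)
  then show ?thesis
    using card_partition_on_eq_Stirling[OF finite_elements[OF assms]] by simp
qed

section \<open>Simplices contained in the blocks of a partition\<close>

text \<open>This is the set \<open>m(P)\<close> of the overview.\<close>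

definition contained_simplices :: "nat \<Rightarrow> 'a set set \<Rightarrow> 'a set set \<Rightarrow> 'a set set" where
  "contained_simplices s K P = {\<sigma> \<in> simplices s K. \<exists>B\<in>P. \<sigma> \<subseteq> B}"

lemma simplices_nonempty: "\<sigma> \<in> simplices s K \<Longrightarrow> \<sigma> \<noteq> {}"
  by (auto simp: simplices_def)

lemma Union_conn_components: "\<Union>(conn_components S) = S"
  unfolding conn_components_def by (rule Union_quotient[OF equiv_connected_rel])

lemma conn_component_closed_under_Int:
  assumes "C \<in> conn_components S" and "\<sigma> \<in> C" and "\<tau> \<in> S" and "\<sigma> \<inter> \<tau> \<noteq> {}"
  shows "\<tau> \<in> C"
proof -
  have "\<sigma> \<in> S" using assms(1,2) Union_conn_components[of S] by auto
  then have "(\<sigma>, \<tau>) \<in> connected_rel S" using assms by (intro connected_rel_Int)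
  then show ?thesis
    using assms(1,2) in_quotient_imp_closed[OF equiv_connected_rel]
    by (auto simp: conn_components_def)
qed

text \<open>The point is disjointness: if two components share a vertex, a simplex of one meets a
  simplex of the other there, so the components coincide.\<close>

lemma partition_on_simplex_partition:
  assumes "S \<subseteq> simplices s K"
  shows "partition_on (vertices K) (simplex_partition K S)"
proof (rule partition_onI)
  have ne: "\<sigma> \<noteq> {}" if "\<sigma> \<in> S" for \<sigma>
    using that assms simplices_nonempty by blast
  have "\<Union>(vertices ` conn_components S) = \<Union>(\<Union>(conn_components S))"
    by (auto simp: vertices_def)
  then have Un: "\<Union>(vertices ` conn_components S) = vertices S"
    by (simp add: Union_conn_components vertices_def)
  moreover have sub: "vertices S \<subseteq> vertices K"
    using assms by (auto simp: vertices_def simplices_def)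
  ultimately show "\<Union>(simplex_partition K S) = vertices K"
    unfolding simplex_partition_def by auto
  have "vertices C \<noteq> {}" if C: "C \<in> conn_components S" for C
  proof -
    have "C \<noteq> {}" using C in_quotient_imp_non_empty[OF equiv_connected_rel]
      by (auto simp: conn_components_def)
    moreover have "C \<subseteq> S" using C Union_conn_components[of S] by auto
    ultimately show ?thesis using ne by (auto simp: vertices_def)
  qed
  then show "{} \<notin> simplex_partition K S"
    unfolding simplex_partition_def by auto
  have disj: "vertices C = vertices D"
    if C: "C \<in> conn_components S" and D: "D \<in> conn_components S"
      and v: "v \<in> vertices C" "v \<in> vertices D" for C D v
  proof -
    obtain \<sigma> \<tau> where st: "\<sigma> \<in> C" "\<tau> \<in> D" "v \<in> \<sigma>" "v \<in> \<tau>" using v by (auto simp: vertices_def)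
    moreover have "\<tau> \<in> S" using D st Union_conn_components[of S] by auto
    ultimately have "\<tau> \<in> C" using C conn_component_closed_under_Int[OF C, of \<sigma> \<tau>] by auto
    then have "C = D"
      using C D st quotient_disj[OF equiv_connected_rel, of C S D] by (auto simp: conn_components_def)
    then show ?thesis by simp
  qed
  have in_S: "v \<in> vertices S" if "C \<in> conn_components S" "v \<in> vertices C" for C v
    using that Un by auto
  fix p q assume "p \<in> simplex_partition K S" "q \<in> simplex_partition K S" "p \<noteq> q"
  then show "disjnt p q"
    unfolding simplex_partition_def disjnt_iff using disj in_S by auto
qed

text \<open>Lying in a common block is an equivalence relation on \<open>S\<close> that relates
  intersecting simplices. By minimality it contains \<open>connected_rel S\<close>, so no chains of
  simplices have to be followed.\<close>

lemma conn_component_subset_block: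
  assumes P: "disjoint P" and S: "\<And>\<sigma>. \<sigma> \<in> S \<Longrightarrow> \<sigma> \<noteq> {} \<and> (\<exists>B\<in>P. \<sigma> \<subseteq> B)"
    and C: "C \<in> conn_components S"
  shows "\<exists>B\<in>P. vertices C \<subseteq> B"
proof -
  define R where "R = {(\<sigma>, \<tau>). \<sigma> \<in> S \<and> \<tau> \<in> S \<and> (\<exists>B\<in>P. \<sigma> \<subseteq> B \<and> \<tau> \<subseteq> B)}"
  have uniq: "B = B'" if "B \<in> P" "B' \<in> P" "\<sigma> \<subseteq> B" "\<tau> \<subseteq> B'" "\<sigma> \<inter> \<tau> \<noteq> {}" for B B' \<sigma> \<tau>
    using that P unfolding disjoint_def by blast
  \<comment> \<open>The middle simplex is nonempty, so it lies in only one block of the disjoint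
    family \<open>P\<close>.\<close>
  have "trans R"
  proof (rule transI)
    fix \<sigma> \<tau> \<upsilon> assume "(\<sigma>, \<tau>) \<in> R" "(\<tau>, \<upsilon>) \<in> R"
    then obtain B B' where B: "B \<in> P" "B' \<in> P" "\<sigma> \<subseteq> B" "\<tau> \<subseteq> B" "\<tau> \<subseteq> B'" "\<upsilon> \<subseteq> B'"
      "\<sigma> \<in> S" "\<tau> \<in> S" "\<upsilon> \<in> S"
      by (auto simp: R_def)
    moreover have "B = B'" using uniq[OF B(1,2,4,5)] S[OF \<open>\<tau> \<in> S\<close>] by auto
    ultimately show "(\<sigma>, \<upsilon>) \<in> R" by (auto simp: R_def)
  qed
  moreover have "refl_on S R" "sym R" "R \<subseteq> S \<times> S"
    using S by (auto simp: R_def refl_on_def sym_def)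
  ultimately have "equiv S R" by (auto intro: equivI)
  moreover have "(\<sigma>, \<tau>) \<in> R" if st: "\<sigma> \<in> S" "\<tau> \<in> S" "\<sigma> \<inter> \<tau> \<noteq> {}" for \<sigma> \<tau>
  proof -
    obtain B B' where B: "B \<in> P" "B' \<in> P" "\<sigma> \<subseteq> B" "\<tau> \<subseteq> B'" using S st by meson
    then show ?thesis using uniq[OF B st(3)] st by (auto simp: R_def)
  qed
  ultimately have sub: "connected_rel S \<subseteq> R"
    unfolding connected_rel_def by (intro Inter_lower) auto
  obtain \<sigma> where \<sigma>: "\<sigma> \<in> S" "C = connected_rel S `` {\<sigma>}"
    using C by (auto simp: conn_components_def elim: quotientE)
  obtain B where B: "B \<in> P" "\<sigma> \<subseteq> B" using S \<sigma> by blast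
  have "\<tau> \<subseteq> B" if "\<tau> \<in> C" for \<tau>
  proof -
    have "(\<sigma>, \<tau>) \<in> R" using that \<sigma> sub by auto
    then obtain B' where B': "B' \<in> P" "\<sigma> \<subseteq> B'" "\<tau> \<subseteq> B'" by (auto simp: R_def)
    then have "B = B'" using uniq[OF B(1) B'(1) B(2) B'(2)] S[OF \<sigma>(1)] by auto
    then show ?thesis using B' by simp
  qed
  then show ?thesis using B by (auto simp: vertices_def)
qed

text \<open>If every simplex of \<open>T\<close> lies in a block of \<open>P\<close>, so does every
  component, and singletons always do. Conversely, a simplex lies in the vertex set of its
  component, hence in the block that contains this set.\<close>

lemma subset_contained_simplices_iff:
  assumes T: "T \<subseteq> simplices s K" and P: "partition_on (vertices K) P"
  shows "T \<subseteq> contained_simplices s K P \<longleftrightarrow> refines (vertices K) (simplex_partition K T) P"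
proof
  assume "T \<subseteq> contained_simplices s K P"
  then have "\<sigma> \<noteq> {} \<and> (\<exists>B\<in>P. \<sigma> \<subseteq> B)" if "\<sigma> \<in> T" for \<sigma>
    using that simplices_nonempty[of \<sigma> s K] by (auto simp: contained_simplices_def)
  then have "\<exists>B\<in>P. vertices C \<subseteq> B" if "C \<in> conn_components T" for C
    using that partition_onD2[OF P] by (intro conn_component_subset_block[of P T])
  moreover have "\<exists>B\<in>P. {v} \<subseteq> B" if "v \<in> vertices K" for v
    using that P by (auto simp: partition_on_def)
  ultimately show "refines (vertices K) (simplex_partition K T) P"
    using partition_on_simplex_partition[OF T] P
    by (auto simp: refines_def simplex_partition_def)
next
  assume ref: "refines (vertices K) (simplex_partition K T) P"
  show "T \<subseteq> contained_simplices s K P"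
  proof
    fix \<sigma> assume "\<sigma> \<in> T"
    then obtain C where C: "C \<in> conn_components T" "\<sigma> \<in> C"
      using Union_conn_components[of T] by blast
    then obtain B where "B \<in> P" "vertices C \<subseteq> B"
      using ref by (auto simp: refines_def simplex_partition_def)
    then show "\<sigma> \<in> contained_simplices s K P"
      using C T \<open>\<sigma> \<in> T\<close> by (auto simp: contained_simplices_def vertices_def)
  qed
qed

text \<open>A component \<open>C\<close> lies in a single block \<open>B\<close>. Any
  \<open>s\<close>-simplex on vertices of \<open>C\<close> then lies in \<open>B\<close> as well, so
  it is a contained simplex; since it meets a member of \<open>C\<close>, it belongs to
  \<open>C\<close>.\<close>

lemma contained_simplices_in_lattice:
  assumes P: "disjoint P"
  shows "contained_simplices s K P \<in> simplex_lattice s K"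
proof -
  let ?S = "contained_simplices s K P"
  have "closed_simplices s K C" if C: "C \<in> conn_components ?S" for C
  proof -
    have CS: "C \<subseteq> ?S" using C Union_conn_components[of ?S] by auto
    obtain B where B: "B \<in> P" "vertices C \<subseteq> B"
      using conn_component_subset_block[OF P _ C] simplices_nonempty
      by (force simp: contained_simplices_def)
    have "\<sigma> \<in> C" if \<sigma>: "\<sigma> \<in> simplices s K" "\<sigma> \<subseteq> vertices C" for \<sigma>
    proof -
      have "\<sigma> \<in> ?S" using \<sigma> B by (auto simp: contained_simplices_def)
      moreover obtain \<tau> where "\<tau> \<in> C" "\<tau> \<inter> \<sigma> \<noteq> {}"
        using \<sigma> simplices_nonempty[OF \<sigma>(1)] by (fastforce simp: vertices_def)
      ultimately show ?thesis using conn_component_closed_under_Int[OF C] by blast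
    qed
    then show ?thesis
      using CS by (auto simp: closed_simplices_def contained_simplices_def vertices_def)
  qed
  then show ?thesis by (auto simp: simplex_lattice_def contained_simplices_def)
qed

section \<open>Moebius summation and the final count\<close>

text \<open>The recursion for \<open>mobius\<close> sums over \<open>z < y\<close>; moving the term
  at \<open>y\<close> to the other side gives the sum over the closed interval.\<close>

lemma sum_mobius_interval:
  assumes "finite P" and "x \<in> P" and "y \<in> P" and "x \<le> y"
  shows "(\<Sum>z\<in>{z \<in> P. x \<le> z \<and> z \<le> y}. mobius P x z) = (if x = y then 1 else 0)"
proof (cases "x = y")
  case True
  then have "{z \<in> P. x \<le> z \<and> z \<le> y} = {x}" using assms by auto
  then show ?thesis using True assms by (simp add: mobius.simps[of P y y])
next
  case False
  have "{z \<in> P. x \<le> z \<and> z \<le> y} = insert y {z \<in> P. x \<le> z \<and> z < y}"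
    using assms by (auto simp: order.order_iff_strict)
  then have "(\<Sum>z\<in>{z \<in> P. x \<le> z \<and> z \<le> y}. mobius P x z) =
      mobius P x y + (\<Sum>z\<in>{z \<in> P. x \<le> z \<and> z < y}. mobius P x z)"
    using assms(1) by simp
  then show ?thesis
    using False assms by (simp add: mobius.simps[of P x y])
qed

theorem theorem2p30:
  fixes K :: "'a set set" and r s :: nat
  assumes "abstract_complex K" and "finite K" and "vertices K \<noteq> {}"
    and "s \<ge> 1" and "r \<ge> 1"
  shows "int (simplicial_Stirling K r s) =
    (\<Sum>T\<in>simplex_lattice s K.
       mobius (simplex_lattice s K) {} T * int (Stirling (card (simplex_partition K T)) r))"
proof -
  let ?V = "vertices K" and ?L = "simplex_lattice s K"
  let ?m = "contained_simplices s K" and ?\<mu> = "mobius (simplex_lattice s K) {}"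
  define parts where "parts = {P. partition_on ?V P \<and> card P = r}"
  have finV: "finite ?V"
    using assms(1,2) by (auto simp: vertices_def abstract_complex_def)
  have finL: "finite ?L"
    by (rule finite_subset[of _ "Pow K"])
      (use assms(2) in \<open>auto simp: simplex_lattice_def simplices_def\<close>)
  have fin: "finite parts"
    unfolding parts_def by (rule finite_subset[OF _ finitely_many_partition_on[OF finV]]) auto
  have empty_in: "{} \<in> ?L"
    by (auto simp: simplex_lattice_def conn_components_def)
  have m_in: "?m P \<in> ?L" if "P \<in> parts" for P
    using that by (auto simp: parts_def partition_on_def intro: contained_simplices_in_lattice)
  \<comment> \<open>Writing the Stirling number as a sum of indicators over a range independent of
    \<open>T\<close> allows the sums to be exchanged.\<close>
  have coarse: "int (Stirling (card (simplex_partition K T)) r) =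
      (\<Sum>P\<in>parts. if T \<subseteq> ?m P then 1 else 0)" if "T \<in> ?L" for T
  proof -
    have T: "T \<subseteq> simplices s K" using that by (simp add: simplex_lattice_def)
    have "{P \<in> parts. T \<subseteq> ?m P} = {P. refines ?V (simplex_partition K T) P \<and> card P = r}"
      using subset_contained_simplices_iff[OF T] by (auto simp: parts_def refines_def)
    then have "card {P \<in> parts. T \<subseteq> ?m P} = Stirling (card (simplex_partition K T)) r"
      using card_coarsenings[OF finV partition_on_simplex_partition[OF T]] by simp
    moreover have "(\<Sum>P\<in>parts. if T \<subseteq> ?m P then 1 else 0) = int (card {P \<in> parts. T \<subseteq> ?m P})"
      using fin by (simp add: sum.inter_filter[symmetric])
    ultimately show ?thesis by simp
  qed
  have "(\<Sum>T\<in>?L. ?\<mu> T * int (Stirling (card (simplex_partition K T)) r)) =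
      (\<Sum>T\<in>?L. \<Sum>P\<in>parts. if T \<subseteq> ?m P then ?\<mu> T else 0)"
    by (intro sum.cong refl) (simp add: coarse sum_distrib_left if_distrib cong: if_cong)
  also have "\<dots> = (\<Sum>P\<in>parts. \<Sum>T\<in>?L. if T \<subseteq> ?m P then ?\<mu> T else 0)"
    by (rule sum.swap)
  \<comment> \<open>The condition \<open>{} \<subseteq> T\<close> always holds; it gives the index
    set the shape of the interval from \<open>{}\<close> to \<open>?m P\<close> in the
    lattice.\<close>
  also have "\<dots> = (\<Sum>P\<in>parts. \<Sum>T\<in>{T \<in> ?L. {} \<subseteq> T \<and> T \<subseteq> ?m P}. ?\<mu> T)"
    using finL by (simp add: sum.inter_filter)
  also have "\<dots> = (\<Sum>P\<in>parts. if {} = ?m P then 1 else 0)"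
    using finL empty_in m_in by (intro sum.cong refl sum_mobius_interval) auto
  also have "\<dots> = int (card {P \<in> parts. {} = ?m P})"
    using fin by (simp add: sum.inter_filter[symmetric])
  also have "{P \<in> parts. {} = ?m P} =
      {P. partition_on ?V P \<and> card P = r \<and> (\<forall>B\<in>P. \<not> (\<exists>\<sigma>\<in>simplices s K. \<sigma> \<subseteq> B))}"
    by (auto simp: parts_def contained_simplices_def)
  finally show ?thesis by (simp add: simplicial_Stirling_def)
qed

end
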